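(* Let $P(t)\in\mathbb{DH}[t]$ be a $\Delta$-free monic motion polynomial of degree $n>0$. Then $P(t)$ admits a factorization $P(t)=(t-h^{(1)})\cdot\ldots\cdot(t-h^{(n)})$ with $h^{(1)},\ldots,h^{(n)}\in(\mathbb{R}+\epsilon\,\mathrm{Im}(\mathbb{H}))\cup Q_{\mathbb{DH}}$.
   Context: $\mathbb{H}$ is the algebra of quaternions, with conjugation $q\mapsto q^c$; $\mathrm{Im}(\mathbb{H})$ is the space of purely imaginary quaternions. The dual quaternions are $\mathbb{DH}=\mathbb{H}+\epsilon\mathbb{H}$, with elements $h=h_1+\epsilon h_2$, componentwise addition and product $hh'=h_1h'_1+\epsilon(h_1h'_2+h_2h'_1)$; $\pi(h)=h_1$ is the primal part. Put $h^c=h_1^c+\epsilon h_2^c$, $t(h)=h+h^c$, $n(h)=hh^c$. Let $\mathbb{S}_{\mathbb{DH}}=\{J\in\mathbb{DH}: t(J)=0,\ n(J)=1\}$ and $Q_{\mathbb{DH}}=\{\alpha+\beta J:\alpha,\beta\in\mathbb{R},\ J\in\mathbb{S}_{\mathbb{DH}}\}$. $\mathbb{DH}[t]$ is the *-algebra of polynomials $\sum t^na_n$ with $a_n\in\mathbb{DH}$, where the indeterminate $t$ commutes with the coefficients: $\sum t^na_n\cdot\sum t^nb_n=\sum t^n\sum_{\ell=0}^na_\ell b_{n-\ell}$ and $(\sum t^na_n)^c=\sum t^na_n^c$. $\mathbb{H}[t]\subset\mathbb{DH}[t]$ is the subalgebra of quaternionic polynomials, and $\mathrm{primal}(\sum t^na_n)=\sum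 t^n\pi(a_n)\in\mathbb{H}[t]$. The norm of $P$ is $N(P)(t)=P(t)\cdot P^c(t)$. $P(t)$ is a motion polynomial if $N(P)(t)\in\mathbb{R}[t]$ and the leading coefficient of $P$ is invertible in $\mathbb{DH}$ (i.e. has nonzero primal part). For $y\in\mathbb{DH}$ put $\Delta_y(t)=(t-y)\cdot(t-y^c)=t^2-t\,t(y)+n(y)$, which is a real polynomial exactly when $y\in(\mathbb{R}+\epsilon\,\mathrm{Im}(\mathbb{H}))\cup Q_{\mathbb{DH}}$. A motion polynomial $P(t)$ is $\Delta$-free if $\Delta_y(t)$ does not divide $\mathrm{primal}(P)(t)$ in $\mathbb{H}[t]$ for any $y\in(\mathbb{R}+\epsilon\,\mathrm{Im}(\mathbb{H}))\cup Q_{\mathbb{DH}}$ (equivalently, for any $y\in\mathbb{H}$). *)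

theory Defs
  imports Complex_Main "HOL-Library.Poly_Mapping"
begin

section \<open>Quaternions\<close>

datatype quat = Quat (quat_re: real) (quat_i: real) (quat_j: real) (quat_k: real)

lemma quat_eq_iff:
  "p = q \<longleftrightarrow> quat_re p = quat_re q \<and> quat_i p = quat_i q \<and> quat_j p = quat_j q \<and> quat_k p = quat_k q"
  by (auto intro: quat.expand)

instantiation quat :: real_algebra_1
begin

definition zero_quat :: quat where "0 = Quat 0 0 0 0"
definition one_quat :: quat where "1 = Quat 1 0 0 0"
definition plus_quat :: "quat \<Rightarrow> quat \<Rightarrow> quat" where
  "p + q = Quat (quat_re p + quat_re q) (quat_i p + quat_i q) (quat_j p + quat_j q) (quat_k p + quat_k q)"
definition uminus_quat :: "quat \<Rightarrow> quat" where
  "- q = Quat (- quat_re q) (- quat_i q) (- quat_j q) (- quat_k q)"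
definition minus_quat :: "quat \<Rightarrow> quat \<Rightarrow> quat" where
  "p - q = Quat (quat_re p - quat_re q) (quat_i p - quat_i q) (quat_j p - quat_j q) (quat_k p - quat_k q)"
definition scaleR_quat :: "real \<Rightarrow> quat \<Rightarrow> quat" where
  "r *\<^sub>R q = Quat (r * quat_re q) (r * quat_i q) (r * quat_j q) (r * quat_k q)"
definition times_quat :: "quat \<Rightarrow> quat \<Rightarrow> quat" where
  "p * q = Quat
     (quat_re p * quat_re q - quat_i p * quat_i q - quat_j p * quat_j q - quat_k p * quat_k q)
     (quat_re p * quat_i q + quat_i p * quat_re q + quat_j p * quat_k q - quat_k p * quat_j q)
     (quat_re p * quat_j q - quat_i p * quat_k q + quat_j p * quat_re q + quat_k p * quat_i q)
     (quat_re p * quat_k q + quat_i p * quat_j q - quat_j p * quat_i q + quat_k p * quat_re q)"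

instance
  by standard
    (simp_all add: quat_eq_iff zero_quat_def one_quat_def plus_quat_def uminus_quat_def
      minus_quat_def scaleR_quat_def times_quat_def algebra_simps)

end

definition quat_conj :: "quat \<Rightarrow> quat" where
  "quat_conj q = Quat (quat_re q) (- quat_i q) (- quat_j q) (- quat_k q)"

definition quat_Im :: "quat set" where
  "quat_Im = {q. quat_re q = 0}"


section \<open>Dual quaternions\<close>

text \<open>\<open>DQuat a b\<close> stands for \<open>a + \<epsilon> b\<close>.\<close>

datatype dquat = DQuat (dq_primal: quat) (dq_dual: quat)

lemma dquat_eq_iff: "x = y \<longleftrightarrow> dq_primal x = dq_primal y \<and> dq_dual x = dq_dual y"
  by (auto intro: dquat.expand)

instantiation dquat :: real_algebra_1
begin

definition zero_dquat :: dquat where "0 = DQuat 0 0"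
definition one_dquat :: dquat where "1 = DQuat 1 0"
definition plus_dquat :: "dquat \<Rightarrow> dquat \<Rightarrow> dquat" where
  "x + y = DQuat (dq_primal x + dq_primal y) (dq_dual x + dq_dual y)"
definition uminus_dquat :: "dquat \<Rightarrow> dquat" where
  "- x = DQuat (- dq_primal x) (- dq_dual x)"
definition minus_dquat :: "dquat \<Rightarrow> dquat \<Rightarrow> dquat" where
  "x - y = DQuat (dq_primal x - dq_primal y) (dq_dual x - dq_dual y)"
definition scaleR_dquat :: "real \<Rightarrow> dquat \<Rightarrow> dquat" where
  "r *\<^sub>R x = DQuat (r *\<^sub>R dq_primal x) (r *\<^sub>R dq_dual x)"
definition times_dquat :: "dquat \<Rightarrow> dquat \<Rightarrow> dquat" where
  "x * y = DQuat (dq_primal x * dq_primal y) (dq_primal x * dq_dual y + dq_dual x * dq_primal y)"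

instance
  by standard
    (simp_all add: dquat_eq_iff zero_dquat_def one_dquat_def plus_dquat_def uminus_dquat_def
      minus_dquat_def scaleR_dquat_def times_dquat_def algebra_simps)

end

definition dquat_of_quat :: "quat \<Rightarrow> dquat" where
  "dquat_of_quat q = DQuat q 0"

definition dq_eps :: dquat where
  "dq_eps = DQuat 0 1"

lemma DQuat_conv: "DQuat a b = dquat_of_quat a + dq_eps * dquat_of_quat b"
  by (simp add: dquat_eq_iff dquat_of_quat_def dq_eps_def plus_dquat_def times_dquat_def)

definition dq_conj :: "dquat \<Rightarrow> dquat" where
  "dq_conj h = DQuat (quat_conj (dq_primal h)) (quat_conj (dq_dual h))"

definition dq_trace :: "dquat \<Rightarrow> dquat" where
  "dq_trace h = h + dq_conj h"

definition dq_norm :: "dquat \<Rightarrow> dquat" where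
  "dq_norm h = h * dq_conj h"

definition S_DH :: "dquat set" where
  "S_DH = {J. dq_trace J = 0 \<and> dq_norm J = 1}"

definition Q_DH :: "dquat set" where
  "Q_DH = {of_real \<alpha> + of_real \<beta> * J | \<alpha> \<beta> J. J \<in> S_DH}"

text \<open>The set \<open>\<real> + \<epsilon> Im(\<H>)\<close>.\<close>

definition real_eps_Im :: "dquat set" where
  "real_eps_Im = {of_real r + dq_eps * dquat_of_quat v | r v. v \<in> quat_Im}"

definition dq_invertible :: "dquat \<Rightarrow> bool" where
  "dq_invertible a \<longleftrightarrow> (\<exists>b. a * b = 1 \<and> b * a = 1)"


section \<open>Polynomials with a central indeterminate\<close>

text \<open>
  The product of the type \<open>'a poly\<close> is only available over commutative coefficients.
  Finitely supported maps on \<open>nat\<close> carry the convolution product over an arbitrary ring, and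
  \<open>Poly_Mapping.single n a\<close> is the monomial \<open>t\<^sup>n a\<close>.
\<close>

type_synonym 'a npoly = "nat \<Rightarrow>\<^sub>0 'a"

abbreviation ncoeff :: "'a::zero npoly \<Rightarrow> nat \<Rightarrow> 'a" where
  "ncoeff \<equiv> Poly_Mapping.lookup"

definition nconst :: "'a::zero \<Rightarrow> 'a npoly" where
  "nconst a = Poly_Mapping.single 0 a"

definition nvar :: "'a::zero_neq_one npoly" where
  "nvar = Poly_Mapping.single 1 1"

text \<open>\<open>Poly_Mapping.degree\<close> is one more than the usual degree of a nonzero polynomial.\<close>

definition ndegree :: "'a::zero npoly \<Rightarrow> nat" where
  "ndegree P = Poly_Mapping.degree P - 1"

definition nlead :: "'a::zero npoly \<Rightarrow> 'a" where
  "nlead P = ncoeff P (ndegree P)"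

definition nmonic :: "'a::zero_neq_one npoly \<Rightarrow> bool" where
  "nmonic P \<longleftrightarrow> nlead P = 1"

definition poly_conj :: "dquat npoly \<Rightarrow> dquat npoly" where
  "poly_conj P = Poly_Mapping.map dq_conj P"

definition poly_primal :: "dquat npoly \<Rightarrow> quat npoly" where
  "poly_primal P = Poly_Mapping.map dq_primal P"

text \<open>The inclusion of \<open>\<H>[t]\<close> into \<open>\<D>\<H>[t]\<close>.\<close>

definition poly_embed :: "quat npoly \<Rightarrow> dquat npoly" where
  "poly_embed P = Poly_Mapping.map dquat_of_quat P"

text \<open>
  \<open>Poly_Mapping.map f\<close> applies \<open>f\<close> to nonzero coefficients only; as the three maps
  above preserve \<open>0\<close>, they act on every coefficient.
\<close>

lemma ncoeff_poly_conj: "ncoeff (poly_conj P) n = dq_conj (ncoeff P n)"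
  by (simp add: poly_conj_def Poly_Mapping.map.rep_eq when_def dq_conj_def quat_conj_def
      zero_dquat_def zero_quat_def)

lemma ncoeff_poly_primal: "ncoeff (poly_primal P) n = dq_primal (ncoeff P n)"
  by (simp add: poly_primal_def Poly_Mapping.map.rep_eq when_def zero_dquat_def)

lemma ncoeff_poly_embed: "ncoeff (poly_embed P) n = dquat_of_quat (ncoeff P n)"
  by (simp add: poly_embed_def Poly_Mapping.map.rep_eq when_def dquat_of_quat_def zero_dquat_def)

definition poly_norm :: "dquat npoly \<Rightarrow> dquat npoly" where
  "poly_norm P = P * poly_conj P"

definition motion_poly :: "dquat npoly \<Rightarrow> bool" where
  "motion_poly P \<longleftrightarrow> (\<forall>n. ncoeff (poly_norm P) n \<in> \<real>) \<and> dq_invertible (nlead P)"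

definition Delta :: "dquat \<Rightarrow> dquat npoly" where
  "Delta y = (nvar - nconst y) * (nvar - nconst (dq_conj y))"

lemma Delta_expand: "Delta y = nvar\<^sup>2 - nvar * nconst (dq_trace y) + nconst (dq_norm y)"
  by (simp add: Delta_def nvar_def nconst_def dq_trace_def dq_norm_def algebra_simps
      power2_eq_square mult_single single_add)

text \<open>
  For the \<open>y\<close> considered, \<open>Delta y\<close> has real coefficients, so that it lies in \<open>\<H>[t]\<close>
  and is central; hence left and right divisibility agree. The cofactor \<open>K\<close> is required
  to lie in \<open>\<H>[t]\<close>.
\<close>

definition Delta_free :: "dquat npoly \<Rightarrow> bool" where
  "Delta_free P \<longleftrightarrow>
     (\<forall>y \<in> real_eps_Im \<union> Q_DH. \<not> (\<exists>K :: quat npoly. poly_embed (poly_primal P) = Delta y * poly_embed K))"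

end

theory Submission
  imports Defs "HOL-Computational_Algebra.Fundamental_Theorem_Algebra"
begin

text \<open>
  The norm polynomial of \<open>P\<close> has real coefficients and, being a sum of four squares, is
  nonnegative on the real line; hence it has a monic real quadratic factor
  \<open>M = t\<^sup>2 - a t + b\<close> with \<open>a\<^sup>2 \<le> 4 b\<close>. Divide: \<open>P = Q M + r\<^sub>1 t + r\<^sub>0\<close>. Then \<open>M\<close> divides the norm
  polynomial of the remainder, and \<open>\<Delta>\<close>-freeness makes \<open>r\<^sub>1\<close> invertible. The zero
  \<open>h = - r\<^sub>1\<^sup>-\<^sup>1 r\<^sub>0\<close> of the remainder satisfies \<open>\<Delta>\<^sub>h = M\<close>, so \<open>t - h\<close> is a right factor of \<open>P\<close>,
  and the cofactor is again a \<open>\<Delta>\<close>-free motion polynomial.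
\<close>

section \<open>Dual quaternions\<close>

lemmas quat_defs = zero_quat_def one_quat_def plus_quat_def uminus_quat_def
  minus_quat_def scaleR_quat_def times_quat_def quat_conj_def

lemmas dquat_defs = zero_dquat_def one_dquat_def plus_dquat_def uminus_dquat_def
  minus_dquat_def scaleR_dquat_def times_dquat_def dq_conj_def

lemma of_real_quat: "of_real r = Quat r 0 0 0"
  by (simp add: of_real_def quat_defs)

lemma of_real_dquat: "of_real r = DQuat (Quat r 0 0 0) 0"
  by (simp add: of_real_def dquat_defs quat_defs)

lemma dquat_of_quat_hom:
  "dquat_of_quat 0 = 0"
  "dquat_of_quat (p + q) = dquat_of_quat p + dquat_of_quat q"
  "dquat_of_quat (p * q) = dquat_of_quat p * dquat_of_quat q"
  by (simp_all add: dquat_of_quat_def dquat_defs)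

lemma dq_primal_hom:
  "dq_primal 0 = 0"
  "dq_primal (x + y) = dq_primal x + dq_primal y"
  "dq_primal (x * y) = dq_primal x * dq_primal y"
  by (simp_all add: dquat_defs)

lemma of_real_dquat_commute: "of_real r * (x :: dquat) = x * of_real r"
  by (simp add: of_real_def)

lemma dq_conj_mult: "dq_conj (x * y) = dq_conj y * dq_conj x"
  by (simp add: dquat_defs quat_defs algebra_simps)

lemma dq_conj_add: "dq_conj (x + y) = dq_conj x + dq_conj y"
  by (simp add: dquat_defs quat_defs)

lemma dq_conj_uminus: "dq_conj (- x) = - dq_conj x"
  by (simp add: dquat_defs quat_defs)

lemma dq_conj_0: "dq_conj 0 = 0"
  by (simp add: dquat_defs quat_defs)

lemma dq_conj_of_real: "dq_conj (of_real r) = of_real r"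
  by (simp add: of_real_dquat dquat_defs quat_defs)

lemma quat_norm: "q * quat_conj q =
    of_real ((quat_re q)\<^sup>2 + (quat_i q)\<^sup>2 + (quat_j q)\<^sup>2 + (quat_k q)\<^sup>2)"
  by (simp add: quat_defs of_real_quat power2_eq_square)

lemma quat_norm_eq_0_iff: "q * quat_conj q = 0 \<longleftrightarrow> q = 0"
  unfolding quat_norm of_real_eq_0_iff
  by (simp add: quat_eq_iff zero_quat_def add_nonneg_eq_0_iff)

lemma quat_inverse:
  assumes "q \<noteq> 0"
  obtains p :: quat where "p * q = 1" "q * p = 1"
proof -
  define s where "s = (quat_re q)\<^sup>2 + (quat_i q)\<^sup>2 + (quat_j q)\<^sup>2 + (quat_k q)\<^sup>2"
  have s: "q * quat_conj q = of_real s" "quat_conj q * q = of_real s"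
    by (simp_all add: s_def quat_norm) (simp add: quat_defs of_real_quat power2_eq_square)
  have "s \<noteq> 0"
    using assms s(1) quat_norm_eq_0_iff[of q] by auto
  then have "((1 / s) *\<^sub>R quat_conj q) * q = 1" "q * ((1 / s) *\<^sub>R quat_conj q) = 1"
    by (simp_all add: s) (simp_all add: of_real_def)
  then show ?thesis
    by (rule that)
qed

text \<open>Since \<epsilon> squares to 0, inverting the primal part p of x suffices: the series for
  the inverse stops after the term linear in \<epsilon>, which gives the witness
  \<open>y\<close>.\<close>

lemma dquat_inverse:
  assumes "dq_primal x \<noteq> 0"
  obtains y where "y * x = 1" "x * y = 1"
proof -
  obtain p where p: "p * dq_primal x = 1" "dq_primal x * p = 1"
    using quat_inverse assms by blast
  define y where "y = DQuat p (- (p * dq_dual x * p))"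
  have "y * x = 1"
    using p by (simp add: y_def dquat_defs mult.assoc)
  moreover have "x * y = 1"
    using p by (simp add: y_def dquat_defs mult.assoc[symmetric])
  ultimately show ?thesis
    by (rule that)
qed

text \<open>A real trace kills the real component of the dual part, and a real norm makes the primal
  and dual vector parts orthogonal. This is how the zeros found later are placed in the required
  set.\<close>

lemma dq_trace_norm_real_imp:
  assumes "dq_trace h = of_real a" "dq_norm h = of_real b"
  shows "h \<in> real_eps_Im \<union> Q_DH"
proof -
  obtain r x y z r' x' y' z' where h: "h = DQuat (Quat r x y z) (Quat r' x' y' z')"
    by (metis dquat.exhaust quat.exhaust)
  have r': "r' = 0"
    using assms(1) by (simp add: h dq_trace_def of_real_dquat dquat_defs quat_defs)
  have "2 * (x * x' + y * y' + z * z') = 0"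
    using assms(2) r' by (simp add: h dq_norm_def of_real_dquat dquat_defs quat_defs algebra_simps)
  then have orth: "x * x' + y * y' + z * z' = 0"
    by simp
  define s where "s = sqrt (x\<^sup>2 + y\<^sup>2 + z\<^sup>2)"
  have s2: "s * s = x * x + y * y + z * z"
    by (simp add: s_def power2_eq_square)
  show ?thesis
  proof (cases "s = 0")
    case True
    then have "x = 0" "y = 0" "z = 0"
      by (simp_all add: s_def add_nonneg_eq_0_iff)
    then have "h = of_real r + dq_eps * dquat_of_quat (Quat 0 x' y' z')"
      by (simp add: h r' of_real_dquat dq_eps_def dquat_of_quat_def dquat_defs quat_defs)
    then have "h \<in> real_eps_Im"
      by (auto simp: real_eps_Im_def quat_Im_def intro!: exI[of _ r] exI[of _ "Quat 0 x' y' z'"])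
    then show ?thesis ..
  next
    case False
    \<comment> \<open>The whole vector part of \<open>h\<close>, dual part included, is divided by
      the length \<open>s\<close> of its primal vector; orthogonality removes the dual part of the
      norm of \<open>J\<close>.\<close>
    define J where "J = DQuat (Quat 0 (x / s) (y / s) (z / s)) (Quat 0 (x' / s) (y' / s) (z' / s))"
    have "x / s * (x / s) + y / s * (y / s) + z / s * (z / s) = 1"
      using False s2 by (simp add: add_divide_distrib[symmetric] s2[symmetric])
    moreover have "2 * (x / s * (x' / s) + y / s * (y' / s) + z / s * (z' / s)) = 0"
      using False orth by (simp add: field_simps)
    ultimately have "J \<in> S_DH"
      by (simp add: J_def S_DH_def dq_trace_def dq_norm_def dquat_defs quat_defs algebra_simps)
    moreover have "h = of_real r + of_real s * J"
      using False by (simp add: h r' J_def of_real_dquat dquat_defs quat_defs)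
    ultimately show ?thesis
      by (auto simp: Q_DH_def)
  qed
qed

text \<open>The witness is the root a/2 + i sqrt (b - a^2/4) of t^2 - a t + b in a copy of the
  complex numbers. It exhibits such a quadratic as some \<open>Delta y\<close>, so that
  \<open>Delta_free\<close> applies to it.\<close>

lemma ex_dq_trace_norm:
  fixes a b :: real
  assumes "a\<^sup>2 \<le> 4 * b"
  obtains y where "dq_trace y = of_real a" "dq_norm y = of_real b"
proof -
  define y where "y = DQuat (Quat (a / 2) (sqrt (b - a\<^sup>2 / 4)) 0 0) 0"
  have s: "sqrt (b - a\<^sup>2 / 4) * sqrt (b - a\<^sup>2 / 4) = b - a * a / 4"
    using assms by (simp add: power2_eq_square)
  have "dq_trace y = of_real a"
    by (simp add: y_def dq_trace_def of_real_dquat dquat_defs quat_defs)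
  moreover have "dq_norm y = of_real b"
    using s by (simp add: y_def dq_norm_def of_real_dquat dquat_defs quat_defs)
  ultimately show ?thesis
    by (rule that)
qed

section \<open>Polynomials over a noncommutative ring\<close>

lemma ncoeff_mult:
  fixes P Q :: "'a::ring_1 npoly"
  shows "ncoeff (P * Q) k = (\<Sum>i\<le>k. ncoeff P i * ncoeff Q (k - i))"
proof -
  have inner: "(\<Sum>q. ncoeff Q q when k = l + q) = (ncoeff Q (k - l) when l \<le> k)" for l
  proof (cases "l \<le> k")
    case True
    then have "(\<lambda>q. ncoeff Q q when k = l + q) = (\<lambda>q. ncoeff Q q when q = k - l)"
      by (auto simp: when_def fun_eq_iff)
    then have "(\<Sum>q. ncoeff Q q when k = l + q) = (\<Sum>q. ncoeff Q q when q = k - l)"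
      by (rule arg_cong)
    with True show ?thesis
      by simp
  qed (auto simp: when_def)
  have "ncoeff (P * Q) k = (\<Sum>l. ncoeff P l * (ncoeff Q (k - l) when l \<le> k))"
    by (simp add: lookup_mult inner)
  also have "\<dots> = (\<Sum>l\<le>k. ncoeff P l * (ncoeff Q (k - l) when l \<le> k))"
    by (rule Sum_any.expand_superset) (auto simp: when_def)
  also have "\<dots> = (\<Sum>i\<le>k. ncoeff P i * ncoeff Q (k - i))"
    by (intro sum.cong) auto
  finally show ?thesis .
qed

section \<open>Coefficients of products with constants and with the indeterminate\<close>

lemma ncoeff_nconst: "ncoeff (nconst c) k = (if k = 0 then c else 0)"
  by (simp add: nconst_def lookup_single when_def)

lemma ncoeff_nvar: "ncoeff nvar k = (if k = 1 then 1 else 0)"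
  by (simp add: nvar_def lookup_single when_def)

lemma ncoeff_mult_nconst: "ncoeff (P * nconst (c :: 'a::ring_1)) k = ncoeff P k * c"
proof -
  have "ncoeff (P * nconst c) k = (\<Sum>i\<le>k. if i = k then ncoeff P i * c else 0)"
    unfolding ncoeff_mult by (intro sum.cong) (auto simp: ncoeff_nconst)
  then show ?thesis
    by simp
qed

lemma ncoeff_nconst_mult: "ncoeff (nconst (c :: 'a::ring_1) * P) k = c * ncoeff P k"
proof -
  have "ncoeff (nconst c * P) k = (\<Sum>i\<le>k. if i = 0 then c * ncoeff P k else 0)"
    unfolding ncoeff_mult by (intro sum.cong) (auto simp: ncoeff_nconst)
  then show ?thesis
    by simp
qed

lemma ncoeff_mult_nvar_0: "ncoeff (P * nvar) 0 = (0 :: 'a::ring_1)"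
  by (simp add: ncoeff_mult ncoeff_nvar)

lemma ncoeff_mult_nvar_Suc: "ncoeff (P * nvar) (Suc k) = (ncoeff P k :: 'a::ring_1)"
proof -
  have "ncoeff (P * nvar) (Suc k) = (\<Sum>i\<le>Suc k. if i = k then ncoeff P i else 0)"
    unfolding ncoeff_mult by (intro sum.cong) (auto simp: ncoeff_nvar)
  then show ?thesis
    by simp
qed

lemmas ncoeff_mult_nvar = ncoeff_mult_nvar_0 ncoeff_mult_nvar_Suc

text \<open>Reversing the convolution index exchanges the factors; the order of the coefficients is
  immaterial because those of \<open>nvar\<close> are 0 or 1.\<close>

lemma nvar_commute: "nvar * P = P * (nvar :: 'a::ring_1 npoly)"
proof (rule poly_mapping_eqI)
  fix k
  have "ncoeff (nvar * P) k = (\<Sum>i\<le>k. ncoeff P i * ncoeff nvar (k - i))"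
    unfolding ncoeff_mult
    by (rule sum.reindex_bij_witness[of _ "\<lambda>i. k - i" "\<lambda>i. k - i"]) (auto simp: ncoeff_nvar)
  then show "ncoeff (nvar * P) k = ncoeff (P * nvar) k"
    by (simp add: ncoeff_mult)
qed

section \<open>Finite support and transfer to and from \<open>poly\<close>\<close>

lemma ncoeff_eventually_0:
  obtains N where "\<And>k. k \<ge> N \<Longrightarrow> ncoeff P k = 0"
  using beyond_degree_lookup_zero by blast

text \<open>Downward induction from a bound beyond which all coefficients vanish. It replaces degree
  arguments for cofactors of monic polynomials.\<close>

lemma ncoeff_vanish_downward:
  assumes "\<And>k. k \<ge> n \<Longrightarrow> (\<And>j. j > k \<Longrightarrow> ncoeff P j = 0) \<Longrightarrow> ncoeff P k = 0" "k \<ge> n"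
  shows "ncoeff P k = 0"
proof -
  obtain N where N: "\<And>k. k \<ge> N \<Longrightarrow> ncoeff P k = 0"
    using ncoeff_eventually_0[of P] by blast
  from assms(2) show ?thesis
  proof (induction "N - k" arbitrary: k rule: less_induct)
    case less
    then show ?case
      using N assms(1) by (metis diff_less_mono2 le_trans less_imp_le_nat not_le)
  qed
qed

lemma ex_npoly_of_coeff:
  assumes "f 0 = 0"
  obtains T where "\<And>k. ncoeff T k = f (coeff p k)"
proof
  have "finite {k. f (coeff p k) \<noteq> 0}"
    by (rule finite_subset[of _ "{..degree p}"]) (auto intro: le_degree simp: assms)
  then show "ncoeff (Abs_poly_mapping (\<lambda>k. f (coeff p k))) k = f (coeff p k)" for k
    by simp
qed

lemma ex_poly_of_ncoeff:
  assumes "f 0 = 0"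
  obtains p where "\<And>k. coeff p k = f (ncoeff P k)"
proof -
  obtain N where N: "\<And>k. k \<ge> N \<Longrightarrow> ncoeff P k = 0"
    using ncoeff_eventually_0[of P] by blast
  have "coeff (Abs_poly (\<lambda>k. f (ncoeff P k))) = (\<lambda>k. f (ncoeff P k))"
    by (rule coeff_Abs_poly[of N]) (simp add: N assms)
  then show ?thesis
    using that by metis
qed

section \<open>Real quadratic factors\<close>

lemma map_poly_of_real_add:
  "map_poly complex_of_real (p + q) = map_poly complex_of_real p + map_poly complex_of_real q"
  by (rule poly_eqI) (simp add: coeff_map_poly)

lemma map_poly_of_real_mult:
  "map_poly complex_of_real (p * q) = map_poly complex_of_real p * map_poly complex_of_real q"
  by (rule poly_eqI) (simp add: coeff_map_poly coeff_mult)

text \<open>A complex root z exists. If z is not real, its minimal polynomial over the reals divides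
  p; if z is real, nonnegativity makes it a multiple root.\<close>

lemma real_poly_quadratic_factor:
  fixes p :: "real poly"
  assumes "degree p > 0" and nonneg: "\<And>x. poly p x \<ge> 0"
  obtains a b q where "p = [:b, - a, 1:] * q" "a\<^sup>2 \<le> 4 * b"
proof -
  have "\<not> constant (poly (map_poly complex_of_real p))"
    using assms(1) by (simp add: constant_degree degree_map_poly)
  then obtain z where z: "poly (map_poly complex_of_real p) z = 0"
    using fundamental_theorem_of_algebra by blast
  show ?thesis
  proof (cases "Im z = 0")
    case False
    define a b where "a = 2 * Re z" and "b = (Re z)\<^sup>2 + (Im z)\<^sup>2"
    let ?m = "[:b, - a, 1:]"
    have mz: "poly (map_poly complex_of_real ?m) z = 0"
      by (simp add: map_poly_pCons a_def b_def complex_eq_iff power2_eq_square algebra_simps)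
    have p: "p = ?m * (p div ?m) + p mod ?m"
      by (rule mult_div_mod_eq[symmetric])
    then have "poly (map_poly complex_of_real p) z =
        poly (map_poly complex_of_real ?m) z * poly (map_poly complex_of_real (p div ?m)) z
        + poly (map_poly complex_of_real (p mod ?m)) z"
      by (metis map_poly_of_real_add map_poly_of_real_mult poly_add poly_mult)
    then have rz: "poly (map_poly complex_of_real (p mod ?m)) z = 0"
      using z mz by simp
    have "degree (p mod ?m) < 2"
      using degree_mod_less[of ?m p] by auto
    moreover obtain c r where r: "p mod ?m = pCons c r"
      by (cases "p mod ?m") blast
    ultimately have "degree r = 0"
      by (simp split: if_splits)
    then obtain d where cd: "p mod ?m = [:c, d:]"
      unfolding r by (metis degree_eq_zeroE)
    \<comment> \<open>The remainder c + d t is real and vanishes at a nonreal z: the imaginary part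
      gives d = 0, then c = 0.\<close>
    have "c = 0 \<and> d = 0"
      using rz False by (auto simp: cd complex_eq_iff map_poly_pCons)
    then have "?m dvd p"
      by (simp add: dvd_eq_mod_eq_0 cd)
    then obtain q where "p = ?m * q"
      by (rule dvdE)
    moreover have "a\<^sup>2 \<le> 4 * b"
      by (simp add: a_def b_def power_mult_distrib)
    ultimately show ?thesis
      by (rule that)
  next
    case True
    then have z_real: "z = of_real (Re z)"
      by (simp add: complex_eq_iff)
    have "poly (map_poly complex_of_real p) (of_real x) = of_real (poly p x)" for x
      by (induction p) (simp_all add: map_poly_pCons)
    then have "poly p (Re z) = 0"
      using z z_real by (metis of_real_eq_0_iff)
    then obtain q where q: "p = [:- Re z, 1:] * q"
      by (auto simp: poly_eq_0_iff_dvd)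
    \<comment> \<open>The value 0 at the root is a minimum of p, so the derivative vanishes there
      too.\<close>
    have "poly (pderiv p) (Re z) = 0"
      by (rule DERIV_local_min[of "poly p" _ "Re z" 1]) (use nonneg \<open>poly p (Re z) = 0\<close> in auto)
    then have "poly q (Re z) = 0"
      unfolding q pderiv_mult by (simp add: pderiv_pCons)
    then obtain q' where q': "q = [:- Re z, 1:] * q'"
      by (auto simp: poly_eq_0_iff_dvd)
    have "p = [:(Re z)\<^sup>2, - (2 * Re z), 1:] * q'"
      unfolding q q' mult.assoc[symmetric] by (simp add: power2_eq_square)
    then show ?thesis
      by (rule that) (simp add: power_mult_distrib)
  qed
qed

section \<open>Real quadratics as central elements of the dual quaternion polynomials\<close>

definition real_quadratic :: "real \<Rightarrow> real \<Rightarrow> dquat npoly" where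
  "real_quadratic a b = nvar * nvar - nvar * nconst (of_real a) + nconst (of_real b)"

lemma ncoeff_mult_real_quadratic:
  "ncoeff (X * real_quadratic a b) 0 = ncoeff X 0 * of_real b"
  "ncoeff (X * real_quadratic a b) (Suc 0) = ncoeff X (Suc 0) * of_real b - ncoeff X 0 * of_real a"
  "ncoeff (X * real_quadratic a b) (Suc (Suc k)) =
     ncoeff X k - ncoeff X (Suc k) * of_real a + ncoeff X (Suc (Suc k)) * of_real b"
  by (simp_all add: real_quadratic_def distrib_left right_diff_distrib lookup_add lookup_minus
      mult.assoc[symmetric] ncoeff_mult_nvar ncoeff_mult_nconst)

lemma nconst_of_real_commute: "nconst (of_real r) * X = X * nconst (of_real r :: dquat)"
  by (rule poly_mapping_eqI) (simp add: ncoeff_nconst_mult ncoeff_mult_nconst of_real_dquat_commute)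

lemma real_quadratic_commute: "real_quadratic a b * X = X * real_quadratic a b"
proof -
  have "nvar * nvar * X = X * (nvar * nvar)"
    by (metis mult.assoc nvar_commute)
  moreover have "nvar * nconst (of_real a) * X = X * (nvar * nconst (of_real a))"
    by (metis mult.assoc nvar_commute nconst_of_real_commute)
  ultimately show ?thesis
    by (simp add: real_quadratic_def distrib_left distrib_right left_diff_distrib right_diff_distrib
        nconst_of_real_commute)
qed

lemma Delta_eq_real_quadratic:
  assumes "dq_trace y = of_real a" "dq_norm y = of_real b"
  shows "Delta y = real_quadratic a b"
  by (simp add: Delta_expand assms real_quadratic_def power2_eq_square)

text \<open>The factors of \<open>Delta h\<close> in the other order, as needed for a right factor t
  - h. As \<open>dq_conj h\<close> is a - h, it commutes with \<open>h\<close> and has the same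
  trace and norm.\<close>

lemma Delta_commuted:
  assumes "dq_trace h = of_real a" "dq_norm h = of_real b"
  shows "(nvar - nconst (dq_conj h)) * (nvar - nconst h) = real_quadratic a b"
proof -
  have conj_h: "dq_conj h = of_real a - h"
    using assms(1) by (simp add: dq_trace_def algebra_simps)
  have "dq_conj (dq_conj h) = h"
    by (simp add: dquat_defs quat_defs)
  moreover have "dq_conj h * h = h * dq_conj h"
    by (simp add: conj_h algebra_simps of_real_dquat_commute)
  ultimately have "Delta (dq_conj h) = real_quadratic a b"
    using assms by (intro Delta_eq_real_quadratic) (simp_all add: dq_trace_def dq_norm_def add.commute)
  then show ?thesis
    by (simp add: Delta_def \<open>dq_conj (dq_conj h) = h\<close>)
qed

text \<open>Polynomials with such a division are closed under addition and under multiplication by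
  t; this yields monomials first and then all finite sums.\<close>

lemma real_quadratic_division:
  obtains Q r1 r0 where "P = Q * real_quadratic a b + nconst r1 * nvar + nconst r0"
proof -
  let ?D = "\<lambda>P. \<exists>Q r1 r0. P = Q * real_quadratic a b + nconst r1 * nvar + nconst r0"
  have nconst_add: "nconst (x + y) = nconst x + nconst y" for x y :: dquat
    by (simp add: nconst_def single_add)
  have add: "?D (X + Y)" if X: "?D X" and Y: "?D Y" for X Y
  proof -
    obtain Q r1 r0 where "X = Q * real_quadratic a b + nconst r1 * nvar + nconst r0"
      using X by blast
    moreover obtain Q' s1 s0 where "Y = Q' * real_quadratic a b + nconst s1 * nvar + nconst s0"
      using Y by blast
    ultimately have "X + Y = (Q + Q') * real_quadratic a b + nconst (r1 + s1) * nvar + nconst (r0 + s0)"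
      by (simp add: nconst_add algebra_simps)
    then show ?thesis
      by blast
  qed
  have shift: "?D (X * nvar)" if X: "?D X" for X
  proof -
    obtain Q r1 r0 where X: "X = Q * real_quadratic a b + nconst r1 * nvar + nconst r0"
      using X by blast
    \<comment> \<open>The new term r1 t^2 is rewritten by t^2 = M + a t - b, where M is the
      quadratic.\<close>
    have "X * nvar = (Q * nvar + nconst r1) * real_quadratic a b
        + nconst (r1 * of_real a + r0) * nvar + nconst (- r1 * of_real b)"
    proof (rule poly_mapping_eqI)
      fix k
      consider "k = 0" | "k = Suc 0" | j where "k = Suc (Suc j)"
        by (metis not0_implies_Suc)
      then show "ncoeff (X * nvar) k = ncoeff ((Q * nvar + nconst r1) * real_quadratic a b
          + nconst (r1 * of_real a + r0) * nvar + nconst (- r1 * of_real b)) k"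
      proof cases
        case 3
        then show ?thesis
          by (cases j; cases "j - 1") (simp_all add: X lookup_add ncoeff_mult_nvar ncoeff_mult_real_quadratic ncoeff_nconst)
      qed (simp_all add: X lookup_add ncoeff_mult_nvar ncoeff_mult_real_quadratic ncoeff_nconst)
    qed
    then show ?thesis
      by blast
  qed
  have zero: "?D 0"
    by (intro exI[of _ 0]) (simp add: nconst_def)
  have single: "?D (Poly_Mapping.single k c)" for k c
  proof (induction k)
    case 0
    show ?case
      by (rule exI[of _ 0], rule exI[of _ 0], rule exI[of _ c]) (simp add: nconst_def)
  next
    case (Suc k)
    have "Poly_Mapping.single (Suc k) c = Poly_Mapping.single k c * nvar"
      by (simp add: nvar_def mult_single)
    then show ?case
      using shift[OF Suc] by simp
  qed
  have "?D P"
  proof (induction P rule: update_induct)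
    case const
    show ?case by (rule zero)
  next
    case (update f x c)
    \<comment> \<open>Here \<open>x\<close> is not a key of \<open>f\<close>, so the update adds a
      monomial.\<close>
    have "Poly_Mapping.update x c f = f + Poly_Mapping.single x c"
      using update(1) by (intro poly_mapping_eqI)
        (auto simp: lookup_update lookup_add lookup_single when_def in_keys_iff)
    then show ?case
      using add[OF update(3) single] by simp
  qed
  then show ?thesis
    using that by blast
qed

section \<open>Norms of motion polynomials\<close>

text \<open>Conjugation reverses each product of coefficients; reversing the summation index matches
  this with the convolution in the opposite order.\<close>

lemma poly_conj_mult: "poly_conj (X * Y) = poly_conj Y * poly_conj X"
proof (rule poly_mapping_eqI)
  fix k
  have conj_sum: "dq_conj (sum f A) = (\<Sum>i\<in>A. dq_conj (f i))" for f and A :: "nat set"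
    by (induction A rule: infinite_finite_induct) (simp_all add: dq_conj_add dq_conj_0)
  show "ncoeff (poly_conj (X * Y)) k = ncoeff (poly_conj Y * poly_conj X) k"
    unfolding ncoeff_poly_conj ncoeff_mult conj_sum dq_conj_mult
    by (rule sum.reindex_bij_witness[of _ "\<lambda>i. k - i" "\<lambda>i. k - i"]) auto
qed

lemma poly_conj_add: "poly_conj (X + Y) = poly_conj X + poly_conj Y"
  by (rule poly_mapping_eqI) (simp add: ncoeff_poly_conj lookup_add dq_conj_add)

lemma poly_conj_nconst: "poly_conj (nconst c) = nconst (dq_conj c)"
  by (rule poly_mapping_eqI) (simp add: ncoeff_poly_conj ncoeff_nconst dq_conj_0)

lemma poly_conj_nvar: "poly_conj nvar = nvar"
  by (rule poly_mapping_eqI) (simp add: ncoeff_poly_conj ncoeff_nvar dquat_defs quat_defs)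

lemma poly_conj_linear: "poly_conj (nvar - nconst h) = nvar - nconst (dq_conj h)"
  by (rule poly_mapping_eqI)
    (simp add: ncoeff_poly_conj lookup_minus ncoeff_nvar ncoeff_nconst dquat_defs quat_defs)

lemma poly_conj_real_quadratic: "poly_conj (real_quadratic a b) = real_quadratic a b"
proof -
  have "poly_conj (X - Y) = poly_conj X - poly_conj Y" for X Y
    by (rule poly_mapping_eqI) (simp add: ncoeff_poly_conj lookup_minus dquat_defs quat_defs)
  then show ?thesis
    by (simp add: real_quadratic_def poly_conj_add poly_conj_mult poly_conj_nvar poly_conj_nconst
        dq_conj_of_real nconst_of_real_commute)
qed

text \<open>The real component of the primal part of x * \<open>dq_conj y\<close> is the Euclidean
  inner product of the primal parts. A norm polynomial with real coefficients is therefore the sum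
  of squares of the four primal component polynomials.\<close>

lemma poly_norm_sum_of_squares:
  assumes "\<forall>k. ncoeff (poly_norm P) k \<in> \<real>"
  obtains p :: "real poly" where "\<And>k. ncoeff (poly_norm P) k = of_real (coeff p k)" "\<And>x. poly p x \<ge> 0"
proof -
  obtain p0 where p0: "\<And>k. coeff p0 k = quat_re (dq_primal (ncoeff P k))"
    using ex_poly_of_ncoeff[of "\<lambda>c. quat_re (dq_primal c)" P] by (auto simp: dquat_defs quat_defs)
  obtain p1 where p1: "\<And>k. coeff p1 k = quat_i (dq_primal (ncoeff P k))"
    using ex_poly_of_ncoeff[of "\<lambda>c. quat_i (dq_primal c)" P] by (auto simp: dquat_defs quat_defs)
  obtain p2 where p2: "\<And>k. coeff p2 k = quat_j (dq_primal (ncoeff P k))"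
    using ex_poly_of_ncoeff[of "\<lambda>c. quat_j (dq_primal c)" P] by (auto simp: dquat_defs quat_defs)
  obtain p3 where p3: "\<And>k. coeff p3 k = quat_k (dq_primal (ncoeff P k))"
    using ex_poly_of_ncoeff[of "\<lambda>c. quat_k (dq_primal c)" P] by (auto simp: dquat_defs quat_defs)
  define p where "p = p0 * p0 + p1 * p1 + p2 * p2 + p3 * p3"
  have re_sum: "quat_re (dq_primal (sum f A)) = (\<Sum>i\<in>A. quat_re (dq_primal (f i)))"
    for f and A :: "nat set"
    by (induction A rule: infinite_finite_induct) (simp_all add: dquat_defs quat_defs)
  have "ncoeff (poly_norm P) k = of_real (coeff p k)" for k
  proof -
    have "quat_re (dq_primal (ncoeff (poly_norm P) k)) = coeff p k"
      unfolding poly_norm_def ncoeff_mult ncoeff_poly_conj re_sum p_def coeff_add coeff_mult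
        p0 p1 p2 p3 sum.distrib[symmetric]
      by (simp add: dquat_defs quat_defs)
    moreover obtain r where "ncoeff (poly_norm P) k = of_real r"
      using assms by (auto elim: Reals_cases)
    ultimately show ?thesis
      by (simp add: of_real_dquat)
  qed
  moreover have "poly p x \<ge> 0" for x
    by (simp add: p_def)
  ultimately show ?thesis
    by (rule that)
qed

lemma poly_norm_top_coeff:
  assumes "ncoeff P n = 1" "\<And>k. k > n \<Longrightarrow> ncoeff P k = 0"
  shows "ncoeff (poly_norm P) (n + n) = 1"
proof -
  have "ncoeff (poly_norm P) (n + n) = (\<Sum>i\<le>n + n. if i = n then 1 else 0)"
    unfolding poly_norm_def ncoeff_mult ncoeff_poly_conj
  proof (intro sum.cong refl)
    fix i
    \<comment> \<open>For i < n the second index 2n - i exceeds n, for i > n the first one does;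
      only i = n survives.\<close>
    consider "i < n" | "i = n" | "i > n"
      by linarith
    then show "ncoeff P i * dq_conj (ncoeff P (n + n - i)) = (if i = n then 1 else 0)"
      by cases (simp_all add: assms dq_conj_0 dq_conj_of_real[of 1, simplified])
  qed
  then show ?thesis
    by simp
qed

text \<open>The top coefficient 1 in degree 2n makes the associated real polynomial nonconstant; its
  quadratic factorization is then carried back coefficientwise.\<close>

lemma motion_poly_norm_factor:
  assumes "ncoeff P n = 1" "\<And>k. k > n \<Longrightarrow> ncoeff P k = 0" "n > 0"
    and "\<forall>k. ncoeff (poly_norm P) k \<in> \<real>"
  obtains a b T where "poly_norm P = T * real_quadratic a b" "a\<^sup>2 \<le> 4 * b"
proof -
  obtain p where p: "\<And>k. ncoeff (poly_norm P) k = of_real (coeff p k)" "\<And>x. poly p x \<ge> 0"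
    using poly_norm_sum_of_squares assms(4) by blast
  have "of_real (coeff p (n + n)) = (1 :: dquat)"
    using poly_norm_top_coeff[of P n] assms(1,2) p(1) by metis
  then have "coeff p (n + n) \<noteq> 0"
    by auto
  then have "degree p > 0"
    using \<open>n > 0\<close> le_degree by fastforce
  then obtain a b q where q: "p = [:b, - a, 1:] * q" "a\<^sup>2 \<le> 4 * b"
    using real_poly_quadratic_factor[OF _ p(2)] by metis
  obtain T :: "dquat npoly" where T: "\<And>k. ncoeff T k = of_real (coeff q k)"
    using ex_npoly_of_coeff[of "of_real :: real \<Rightarrow> dquat" q, OF of_real_0] by blast
  have "poly_norm P = T * real_quadratic a b"
  proof (rule poly_mapping_eqI)
    fix k
    consider "k = 0" | "k = Suc 0" | j where "k = Suc (Suc j)"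
      by (metis not0_implies_Suc)
    then show "ncoeff (poly_norm P) k = ncoeff (T * real_quadratic a b) k"
      by cases (simp_all add: p(1) q(1) T ncoeff_mult_real_quadratic
          of_real_mult[symmetric] mult.commute add.commute del: of_real_mult)
  qed
  then show ?thesis
    using q(2) by (rule that)
qed

section \<open>Splitting off a linear factor\<close>

lemma poly_embed_primal_mult:
  "poly_embed (poly_primal (X * Y)) = poly_embed (poly_primal X) * poly_embed (poly_primal Y)"
proof (rule poly_mapping_eqI)
  fix k
  have "dquat_of_quat (dq_primal (sum f A)) = (\<Sum>i\<in>A. dquat_of_quat (dq_primal (f i)))"
    for f and A :: "nat set"
    by (induction A rule: infinite_finite_induct) (simp_all add: dquat_of_quat_hom dq_primal_hom)
  then show "ncoeff (poly_embed (poly_primal (X * Y))) k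
      = ncoeff (poly_embed (poly_primal X) * poly_embed (poly_primal Y)) k"
    by (simp add: ncoeff_poly_embed ncoeff_poly_primal ncoeff_mult dquat_of_quat_hom dq_primal_hom)
qed

lemma poly_embed_mult: "poly_embed (X * Y) = poly_embed X * poly_embed Y"
proof (rule poly_mapping_eqI)
  fix k
  have "dquat_of_quat (sum f A) = (\<Sum>i\<in>A. dquat_of_quat (f i))" for f and A :: "nat set"
    by (induction A rule: infinite_finite_induct) (simp_all add: dquat_of_quat_hom)
  then show "ncoeff (poly_embed (X * Y)) k = ncoeff (poly_embed X * poly_embed Y) k"
    by (simp add: ncoeff_poly_embed ncoeff_mult dquat_of_quat_hom)
qed

text \<open>Taking primal parts is multiplicative, so a forbidden factor of \<open>X\<close> would
  also divide the primal part of \<open>X * Y\<close>. This preserves the hypothesis in the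
  induction.\<close>

lemma Delta_free_left_factor:
  assumes "Delta_free (X * Y)"
  shows "Delta_free X"
  unfolding Delta_free_def
proof (intro ballI notI)
  fix y assume y: "y \<in> real_eps_Im \<union> Q_DH"
    and "\<exists>K. poly_embed (poly_primal X) = Delta y * poly_embed K"
  then obtain K where "poly_embed (poly_primal X) = Delta y * poly_embed K"
    by blast
  then have "poly_embed (poly_primal (X * Y)) = Delta y * poly_embed (K * poly_primal Y)"
    by (simp add: poly_embed_primal_mult poly_embed_mult mult.assoc)
  then show False
    using assms y unfolding Delta_free_def by blast
qed

text \<open>Otherwise the primal part of the whole polynomial would be that of \<open>Q\<close>
  times the quadratic, which equals \<open>Delta y\<close> for an admissible
  \<open>y\<close>.\<close>

lemma Delta_free_remainder:
  assumes "Delta_free (Q * real_quadratic a b + nconst r1 * nvar + nconst r0)" "a\<^sup>2 \<le> 4 * b"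
  shows "dq_primal r1 \<noteq> 0 \<or> dq_primal r0 \<noteq> 0"
proof (rule ccontr)
  assume "\<not> ?thesis"
  then have r: "dq_primal r1 = 0" "dq_primal r0 = 0"
    by auto
  obtain y where y: "dq_trace y = of_real a" "dq_norm y = of_real b"
    using ex_dq_trace_norm assms(2) by blast
  have real: "poly_embed (poly_primal (real_quadratic a b)) = real_quadratic a b"
    by (rule poly_mapping_eqI)
      (auto simp: real_quadratic_def ncoeff_poly_embed ncoeff_poly_primal lookup_add lookup_minus
        ncoeff_mult_nconst ncoeff_nconst ncoeff_nvar of_real_dquat dquat_of_quat_def
        dquat_defs nvar_def mult_single lookup_single when_def)
  have "poly_embed (poly_primal (Q * real_quadratic a b + nconst r1 * nvar + nconst r0))
      = poly_embed (poly_primal (Q * real_quadratic a b))"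
    using r by (intro poly_mapping_eqI)
      (simp add: ncoeff_poly_embed ncoeff_poly_primal lookup_add ncoeff_nconst_mult ncoeff_nconst
        plus_dquat_def times_dquat_def ncoeff_nvar one_dquat_def zero_dquat_def)
  also have "\<dots> = Delta y * poly_embed (poly_primal Q)"
    by (simp add: poly_embed_primal_mult real Delta_eq_real_quadratic[OF y] real_quadratic_commute[of _ _ "poly_embed _"])
  finally show False
    using assms(1) dq_trace_norm_real_imp[OF y] unfolding Delta_free_def by blast
qed

text \<open>Modulo the central quadratic M, the norm of P is that of the remainder R, so R R^c = U
  M. The left side has degree at most 2, so \<open>U\<close> is the constant r1 r1^c; the two lower
  coefficients give the claims.\<close>

lemma remainder_norm:
  assumes P: "P = Q * real_quadratic a b + nconst r1 * nvar + nconst r0"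
    and "poly_norm P = T * real_quadratic a b"
  shows "r1 * dq_conj r0 + r0 * dq_conj r1 = - (r1 * dq_conj r1 * of_real a)"
    and "r0 * dq_conj r0 = r1 * dq_conj r1 * of_real b"
proof -
  let ?M = "real_quadratic a b"
  define R where "R = nconst r1 * nvar + nconst r0"
  define U where "U = T - Q * ?M * poly_conj Q - Q * poly_conj R - R * poly_conj Q"
  have M_comm: "X * ?M * poly_conj Y = X * poly_conj Y * ?M" for X Y
    by (simp add: mult.assoc real_quadratic_commute[of _ _ "poly_conj Y"])
  have "poly_norm P = (Q * ?M + R) * (?M * poly_conj Q + poly_conj R)"
    by (simp add: P R_def poly_norm_def add.assoc poly_conj_add poly_conj_mult poly_conj_real_quadratic)
  also have "\<dots> = (Q * ?M * poly_conj Q + R * poly_conj Q + Q * poly_conj R) * ?M + R * poly_conj R"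
    unfolding distrib_left distrib_right by (simp add: mult.assoc[symmetric] M_comm)
  finally have U: "R * poly_conj R = U * ?M"
    by (simp add: assms(2) U_def algebra_simps)
  have conj_R: "poly_conj R = nconst (dq_conj r1) * nvar + nconst (dq_conj r0)"
    by (simp add: R_def poly_conj_add poly_conj_mult poly_conj_nvar poly_conj_nconst
        nvar_commute[of "nconst _"])
  have t_comm: "X * nvar * nconst c = X * nconst c * nvar" for X and c :: dquat
    by (simp add: mult.assoc nvar_commute[of "nconst c"])
  have "R * poly_conj R = nconst r1 * nconst (dq_conj r1) * nvar * nvar
      + (nconst r1 * nconst (dq_conj r0) + nconst r0 * nconst (dq_conj r1)) * nvar
      + nconst r0 * nconst (dq_conj r0)"
    unfolding conj_R unfolding R_def
    unfolding distrib_left distrib_right by (simp add: mult.assoc[symmetric] t_comm)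
  then have RR: "ncoeff (U * ?M) k = (if k = 0 then r0 * dq_conj r0
      else if k = 1 then r1 * dq_conj r0 + r0 * dq_conj r1
      else if k = 2 then r1 * dq_conj r1 else 0)" for k
    unfolding U
    by (cases k; cases "k - 1"; cases "k - 2") (simp_all add: lookup_add ncoeff_mult_nvar ncoeff_mult_nconst
        ncoeff_nconst)
  \<comment> \<open>Once the later coefficients of \<open>U\<close> vanish, coefficient k + 2 of U M
    is coefficient k of \<open>U\<close>, as M is monic; it is 0 because k + 2 > 2.\<close>
  have U0: "ncoeff U k = 0" if "k \<ge> 1" for k
  proof (rule ncoeff_vanish_downward[OF _ that])
    fix k :: nat assume "k \<ge> 1" and "\<And>j. j > k \<Longrightarrow> ncoeff U j = 0"
    then show "ncoeff U k = 0"
      using RR[of "Suc (Suc k)"] by (simp add: ncoeff_mult_real_quadratic)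
  qed
  have c: "ncoeff U 0 = r1 * dq_conj r1"
    using RR[of 2] U0 by (simp add: ncoeff_mult_real_quadratic numeral_2_eq_2)
  show "r1 * dq_conj r0 + r0 * dq_conj r1 = - (r1 * dq_conj r1 * of_real a)"
    using RR[of 1] U0 c by (simp add: ncoeff_mult_real_quadratic)
  show "r0 * dq_conj r0 = r1 * dq_conj r1 * of_real b"
    using RR[of 0] U0 c by (simp add: ncoeff_mult_real_quadratic)
qed

text \<open>Substituting r0 = - r1 h turns the two identities into statements about
  \<open>dq_trace h\<close> and \<open>dq_norm h\<close> enclosed between r1 and r1^c, both of which
  are invertible.\<close>

lemma linear_remainder_zero:
  assumes x: "x * r1 = 1" "r1 * x = 1"
    and tr: "r1 * dq_conj r0 + r0 * dq_conj r1 = - (r1 * dq_conj r1 * of_real a)"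
    and no: "r0 * dq_conj r0 = r1 * dq_conj r1 * of_real b"
    and h: "h = - (x * r0)"
  shows "dq_trace h = of_real a" "dq_norm h = of_real b"
proof -
  have one: "dq_conj 1 = 1"
    using dq_conj_of_real[of 1] by simp
  have conj_x: "dq_conj r1 * dq_conj x = 1"
    using x(1) by (simp add: dq_conj_mult[symmetric] one)
  have r0: "r0 = - (r1 * h)"
    using x(2) by (simp add: h mult.assoc[symmetric])
  have strip: "y = z" if "r1 * y * dq_conj r1 = r1 * z * dq_conj r1" for y z
  proof -
    have "x * (r1 * y * dq_conj r1) * dq_conj x = x * (r1 * z * dq_conj r1) * dq_conj x"
      using that by simp
    then have "(x * r1) * y * (dq_conj r1 * dq_conj x) = (x * r1) * z * (dq_conj r1 * dq_conj x)"
      by (simp only: mult.assoc)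
    then show ?thesis
      by (simp add: x conj_x)
  qed
  have "r1 * dq_trace h * dq_conj r1 = - (r1 * dq_conj r0 + r0 * dq_conj r1)"
    by (simp add: r0 dq_trace_def dq_conj_uminus dq_conj_mult algebra_simps)
  then show "dq_trace h = of_real a"
    by - (rule strip, simp add: tr mult.assoc of_real_dquat_commute)
  have "r1 * dq_norm h * dq_conj r1 = r0 * dq_conj r0"
    by (simp add: r0 dq_norm_def dq_conj_uminus dq_conj_mult mult.assoc)
  then show "dq_norm h = of_real b"
    by - (rule strip, simp add: no mult.assoc of_real_dquat_commute)
qed

lemma Delta_free_right_factor:
  assumes "ncoeff P n = 1" "\<And>k. k > n \<Longrightarrow> ncoeff P k = 0" "n > 0"
    and "\<forall>k. ncoeff (poly_norm P) k \<in> \<real>" "Delta_free P"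
  obtains a b h P' where "dq_trace h = of_real a" "dq_norm h = of_real b" "P = P' * (nvar - nconst h)"
proof -
  obtain a b T where T: "poly_norm P = T * real_quadratic a b" and ab: "a\<^sup>2 \<le> 4 * b"
    using motion_poly_norm_factor[OF assms(1-4)] .
  obtain Q r1 r0 where P: "P = Q * real_quadratic a b + nconst r1 * nvar + nconst r0"
    using real_quadratic_division by blast
  note R = remainder_norm[OF P T]
  have nz: "dq_primal r1 \<noteq> 0 \<or> dq_primal r0 \<noteq> 0"
    using Delta_free_remainder assms(5) ab by (auto simp: P)
  \<comment> \<open>If it vanished, the second remainder identity would give the primal part of r0
    norm 0, hence make it 0 as well, against \<open>nz\<close>.\<close>
  have "dq_primal r1 \<noteq> 0"
  proof
    assume r1: "dq_primal r1 = 0"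
    have "dq_primal (r0 * dq_conj r0) = 0"
      unfolding R(2) by (simp add: dq_primal_hom r1)
    then have "dq_primal r0 = 0"
      by (simp add: dq_primal_hom dq_conj_def quat_norm_eq_0_iff)
    with nz r1 show False
      by simp
  qed
  then obtain x where x: "x * r1 = 1" "r1 * x = 1"
    using dquat_inverse by blast
  define h where "h = - (x * r0)"
  have h: "dq_trace h = of_real a" "dq_norm h = of_real b"
    using linear_remainder_zero[OF x R h_def] .
  have "r0 = - (r1 * h)"
    using x(2) by (simp add: h_def mult.assoc[symmetric])
  then have "nconst r0 = - (nconst r1 * nconst h)"
    by (simp add: nconst_def mult_single single_uminus)
  \<comment> \<open>The remainder is r1 (t - h) and the quadratic is (t - h^c)(t - h), so t - h is a
    common right factor.\<close>
  then have "P = (Q * (nvar - nconst (dq_conj h)) + nconst r1) * (nvar - nconst h)"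
    unfolding distrib_right mult.assoc Delta_commuted[OF h]
    by (simp add: P right_diff_distrib)
  then show ?thesis
    using that h by blast
qed

text \<open>By centrality of \<open>Delta h\<close>, the norm of P is that of P' times a monic real
  quadratic. Top-down recursions on coefficients then transfer monicity and reality of the norm to
  P'.\<close>

lemma motion_poly_cofactor:
  assumes P: "P = P' * (nvar - nconst h)" and "dq_trace h = of_real a" "dq_norm h = of_real b"
    and "ncoeff P (Suc n) = 1" "\<And>k. k > Suc n \<Longrightarrow> ncoeff P k = 0"
    and real: "\<forall>k. ncoeff (poly_norm P) k \<in> \<real>"
  shows "ncoeff P' n = 1" "\<And>k. k > n \<Longrightarrow> ncoeff P' k = 0"
    "\<forall>k. ncoeff (poly_norm P') k \<in> \<real>"
proof -
  have step: "ncoeff P' k = ncoeff P (Suc k) + ncoeff P' (Suc k) * h" for k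
    by (simp add: P right_diff_distrib lookup_minus ncoeff_mult_nvar ncoeff_mult_nconst)
  show zero: "ncoeff P' k = 0" if "k > n" for k
  proof (rule ncoeff_vanish_downward[of "Suc n"])
    fix k :: nat assume "k \<ge> Suc n" and "\<And>j. j > k \<Longrightarrow> ncoeff P' j = 0"
    then show "ncoeff P' k = 0"
      using step[of k] assms(5)[of "Suc k"] by simp
  qed (use that in simp)
  show "ncoeff P' n = 1"
    using step[of n] assms(4) zero[of "Suc n"] by simp
  have "poly_norm P = P' * Delta h * poly_conj P'"
    by (simp add: P poly_norm_def poly_conj_mult poly_conj_linear Delta_def mult.assoc)
  also have "\<dots> = poly_norm P' * real_quadratic a b"
    by (simp add: Delta_eq_real_quadratic[OF assms(2,3)] poly_norm_def mult.assoc real_quadratic_commute[of _ _ "poly_conj _"])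
  finally have "ncoeff (poly_norm P) (Suc (Suc k)) = ncoeff (poly_norm P') k
      - ncoeff (poly_norm P') (Suc k) * of_real a + ncoeff (poly_norm P') (Suc (Suc k)) * of_real b" for k
    by (simp add: ncoeff_mult_real_quadratic)
  \<comment> \<open>Solved for the lowest index, the relation determines each coefficient from the
    two above it and a real number.\<close>
  then have rec: "ncoeff (poly_norm P') k = ncoeff (poly_norm P) (Suc (Suc k))
      + ncoeff (poly_norm P') (Suc k) * of_real a - ncoeff (poly_norm P') (Suc (Suc k)) * of_real b" for k
    by (simp add: algebra_simps)
  obtain N where N: "\<And>k. k \<ge> N \<Longrightarrow> ncoeff (poly_norm P') k = 0"
    using ncoeff_eventually_0[of "poly_norm P'"] by blast
  show "\<forall>k. ncoeff (poly_norm P') k \<in> \<real>"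
  proof
    fix k
    show "ncoeff (poly_norm P') k \<in> \<real>"
    proof (induction "N - k" arbitrary: k rule: less_induct)
      case less
      show ?case
      proof (cases "k \<ge> N")
        case False
        then have "ncoeff (poly_norm P') (Suc k) \<in> \<real>" "ncoeff (poly_norm P') (Suc (Suc k)) \<in> \<real>"
          by (intro less; simp)+
        then show ?thesis
          using real by (subst rec) (intro Reals_add Reals_diff Reals_mult Reals_of_real; simp)
      qed (simp add: N)
    qed
  qed
qed

text \<open>Degree and monicity are expressed by coefficients, the form that
  \<open>motion_poly_cofactor\<close> returns; this also admits n = 0, where P = 1 is the empty
  product.\<close>

lemma Delta_free_factorization:
  assumes "ncoeff P n = 1" "\<And>k. k > n \<Longrightarrow> ncoeff P k = 0"
    and "\<forall>k. ncoeff (poly_norm P) k \<in> \<real>" "Delta_free P"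
  shows "\<exists>hs. length hs = n \<and> set hs \<subseteq> real_eps_Im \<union> Q_DH \<and>
           P = prod_list (map (\<lambda>h. nvar - nconst h) hs)"
  using assms
proof (induction n arbitrary: P)
  case 0
  have "P = 1"
    using 0 by (intro poly_mapping_eqI) (auto simp: lookup_one when_def)
  then show ?case
    by simp
next
  case (Suc n)
  obtain a b h P' where h: "dq_trace h = of_real a" "dq_norm h = of_real b"
    and P: "P = P' * (nvar - nconst h)"
    using Delta_free_right_factor[OF Suc.prems(1,2) zero_less_Suc Suc.prems(3,4)] .
  obtain hs where "length hs = n" "set hs \<subseteq> real_eps_Im \<union> Q_DH"
    "P' = prod_list (map (\<lambda>h. nvar - nconst h) hs)"
    using Suc.IH[OF motion_poly_cofactor[OF P h Suc.prems(1-3)]]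
      Delta_free_left_factor Suc.prems(4) P by blast
  then show ?case
    using P dq_trace_norm_real_imp[OF h] by (intro exI[of _ "hs @ [h]"]) auto
qed

theorem theorem8p5:
  fixes P :: "dquat npoly" and n :: nat
  assumes "motion_poly P" and "Delta_free P" and "nmonic P"
    and "ndegree P = n" and "n > 0"
  shows "\<exists>hs :: dquat list. length hs = n \<and> set hs \<subseteq> real_eps_Im \<union> Q_DH \<and>
           P = prod_list (map (\<lambda>h. nvar - nconst h) hs)"
proof (rule Delta_free_factorization)
  show "ncoeff P n = 1"
    using assms(3,4) by (simp add: nmonic_def nlead_def)
  show "ncoeff P k = 0" if "k > n" for k
    \<comment> \<open>\<open>ndegree\<close> is \<open>Poly_Mapping.degree\<close> less one, so k >
      n means that k is at least \<open>Poly_Mapping.degree P\<close>.\<close>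
    using assms(4) that by (intro beyond_degree_lookup_zero) (simp add: ndegree_def)
  show "\<forall>k. ncoeff (poly_norm P) k \<in> \<real>"
    using assms(1) by (simp add: motion_poly_def)
qed (rule assms(2))

end
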